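(* Let $X$ and $Y$ be discrete real-valued random variables on a common probability space $(\Omega,\mathcal{A},P)$, with values $\{x_i : i\in I\}$ for $X$ and $\{y_j : j\in J\}$ for $Y$, indexed as in the definition of discreteness given in the context. Assume that there are indices $i,j$ (with $i,i+1\in I$ and $j,j+1\in J$) such that $$P(X=x_{i+1},\,Y=y_j)>0 \quad\text{and}\quad P(X=x_i,\,Y=y_{j+1})>0 .$$ Then the random vector $(X,Y)$ does not have the property WUVS.
   Context: Discreteness: a real-valued random variable $X$ is called discrete if there are a countable index set $I\subset\mathbb{Z}$ and a set of real numbers $\{x_i : i\in I\}\subseteq\mathbb{R}$ with $x_i<x_j$ for $i<j$, such that $P(X=x_i)>0$ for all $i\in I$ and $\sum_{i\in I}P(X=x_i)=1$. For $Y$ the corresponding index set and values are denoted $J\subset\mathbb{Z}$ and $\{y_j : j\in J\}$. Value-at-Risk: for a real-valued random variable $Z$ with cumulative distribution function $F_Z(t)=P(Z\le t)$ and $p\in(0,1)$, $\mathrm{VaR}_p(Z):=\inf\{t\in\mathbb{R} : F_Z(t)\ge p\}$. WUVS (weighted universal Value-at-Risk superadditivity): let $\Delta_n=\{(\theta_1,\dots,\theta_n)\in[0,1]^n : \sum_{i=1}^n\theta_i=1\}$. A random vector $(X_1,\dots,X_n)$ has the property WUVS if $$\mathrm{VaR}_p\Big(\sum_{i=1}^n\theta_iX_i\Big)\ \ge\ \sum_{i=1}^n\mathrm{VaR}_p(\theta_iX_i)\quad\text{for all } p\in(0,1)\text{ and all }(\theta_1,\dots,\theta_n)\in\Delta_n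 .$$ For $(X,Y)$ this is applied with $n=2$. *)

theory Defs
  imports "HOL-Probability.Probability"
begin

text \<open>\<open>discrete_rv M X I x\<close>: \<open>X\<close> is discrete with values \<open>x i\<close>, \<open>i \<in> I\<close>. Countability of \<open>I\<close> is
  automatic. Only the restriction of \<open>x\<close> to \<open>I\<close> matters.\<close>

definition discrete_rv :: "'a measure \<Rightarrow> ('a \<Rightarrow> real) \<Rightarrow> int set \<Rightarrow> (int \<Rightarrow> real) \<Rightarrow> bool" where
  "discrete_rv M X I x \<longleftrightarrow>
     X \<in> borel_measurable M \<and>
     strict_mono_on I x \<and>
     (\<forall>i\<in>I. \<P>(\<omega> in M. X \<omega> = x i) > 0) \<and>
     ((\<lambda>i. \<P>(\<omega> in M. X \<omega> = x i)) has_sum 1) I"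

text \<open>For a real random variable and \<open>0 < p < 1\<close> the set below is nonempty and bounded below, so the
  real-valued \<open>Inf\<close> is the true infimum.\<close>

definition VaR :: "'a measure \<Rightarrow> real \<Rightarrow> ('a \<Rightarrow> real) \<Rightarrow> real" where
  "VaR M p Z = Inf {t. cdf (distr M borel Z) t \<ge> p}"

text \<open>Vectors of length \<open>n\<close> are lists, with components numbered from \<open>0\<close>.\<close>

definition weight_simplex :: "nat \<Rightarrow> real list set" where
  "weight_simplex n = {\<theta>. length \<theta> = n \<and> set \<theta> \<subseteq> {0..1} \<and> (\<Sum>i<n. \<theta> ! i) = 1}"

definition WUVS :: "'a measure \<Rightarrow> ('a \<Rightarrow> real) list \<Rightarrow> bool" where
  "WUVS M Xs \<longleftrightarrow>
     (\<forall>p\<in>{0<..<1}. \<forall>\<theta>\<in>weight_simplex (length Xs).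
        VaR M p (\<lambda>\<omega>. \<Sum>i<length Xs. \<theta> ! i * (Xs ! i) \<omega>)
          \<ge> (\<Sum>i<length Xs. VaR M p (\<lambda>\<omega>. \<theta> ! i * (Xs ! i) \<omega>)))"

end

theory Submission
  imports Defs
begin

text \<open>
  Put \<open>a = x (i + 1)\<close> and \<open>b = y (j + 1)\<close>. The two discordant atoms make \<open>P (X < a, Y = b)\<close>
  and \<open>P (X = a, Y < b)\<close> positive, and these two probabilities drive the argument.

  By symmetry let \<open>P (X < a) \<le> P (Y < b)\<close>. For \<open>p\<close> slightly above \<open>P (Y < b)\<close>, both individual
  Values-at-Risk lie at or above their levels, so superadditivity would force the Value-at-Risk of
  \<open>\<theta> X + (1 - \<theta>) Y\<close> to be at least \<open>\<theta> a + (1 - \<theta>) b\<close>, for every weight. Now let \<open>\<theta>\<close>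
  tend to \<open>0\<close>. The event \<open>\<theta> X + (1 - \<theta>) Y < \<theta> a + (1 - \<theta>) b\<close> then compares \<open>Y\<close> with \<open>b\<close>
  first and breaks ties by comparing \<open>X\<close> with \<open>a\<close>; in the limit it has probability
  \<open>P (Y < b) + P (X < a, Y = b)\<close>, strictly more than \<open>P (Y < b)\<close>. Hence for a small
  positive \<open>\<theta>\<close> and a suitable \<open>p\<close> superadditivity fails. The case \<open>P (Y < b) \<le> P (X < a)\<close>
  uses the other discordant event and weights near \<open>1\<close>.

  The limit is carried out by \<open>lexicographic_event_inner_approximation\<close>, which leaves a uniform
  margin below the levels, and \<open>small_weight_strictly_below\<close>, which chooses the weight.
\<close>

context prob_space
begin

lemma cdf_distr_eq_prob:
  assumes "Z \<in> borel_measurable M"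
  shows "cdf (distr M borel Z) t = \<P>(\<omega> in M. Z \<omega> \<le> t)"
  using assms by (auto simp: cdf_def measure_distr intro!: arg_cong[where f = prob])

lemma VaR_ge:
  assumes [measurable]: "Z \<in> borel_measurable M"
    and "\<P>(\<omega> in M. Z \<omega> < c) < p" and "p < 1"
  shows "c \<le> VaR M p Z"
proof -
  interpret D: real_distribution "distr M borel Z"
    by (rule real_distribution_distr) simp
  have "eventually (\<lambda>t. cdf (distr M borel Z) t > p) at_top"
    using D.cdf_lim_at_top_prob assms(3) by (rule order_tendstoD)
  then obtain t where "cdf (distr M borel Z) t > p"
    by (metis eventually_at_top_linorder order_refl)
  then have "{t. cdf (distr M borel Z) t \<ge> p} \<noteq> {}"
    by (auto intro: less_imp_le)
  moreover have "c \<le> t" if "cdf (distr M borel Z) t \<ge> p" for t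
  proof (rule ccontr)
    assume "\<not> c \<le> t"
    then have "\<P>(\<omega> in M. Z \<omega> \<le> t) \<le> \<P>(\<omega> in M. Z \<omega> < c)"
      by (intro finite_measure_mono) auto
    then show False
      using that assms(2) by (simp add: cdf_distr_eq_prob)
  qed
  ultimately show ?thesis
    unfolding VaR_def by (intro cInf_greatest) auto
qed

lemma VaR_le:
  assumes [measurable]: "Z \<in> borel_measurable M"
    and "0 < p" and "p \<le> \<P>(\<omega> in M. Z \<omega> \<le> t)"
  shows "VaR M p Z \<le> t"
proof -
  interpret D: real_distribution "distr M borel Z"
    by (rule real_distribution_distr) simp
  have "eventually (\<lambda>t. cdf (distr M borel Z) t < p) at_bot"
    using D.cdf_lim_at_bot assms(2) by (rule order_tendstoD)
  then obtain l where l: "\<And>s. s \<le> l \<Longrightarrow> cdf (distr M borel Z) s < p"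
    by (auto simp: eventually_at_bot_linorder)
  have "bdd_below {t. cdf (distr M borel Z) t \<ge> p}"
    by (rule bdd_belowI[where m = l]) (metis l linorder_not_le mem_Collect_eq nle_le)
  then show ?thesis
    unfolding VaR_def using assms(3) by (intro cInf_lower) (auto simp: cdf_distr_eq_prob)
qed

text \<open>The event \<open>Y < b\<close>, or \<open>Y = b\<close> and \<open>X < a\<close>, is an increasing union of events that keep a
  fixed distance from the boundary and bound \<open>X\<close> from above. On such an event a convex combination
  of \<open>X\<close> and \<open>Y\<close> can be estimated uniformly. The probability gained from \<open>Y = b\<close> survives if
  the approximation is close enough.\<close>

lemma lexicographic_event_inner_approximation:
  assumes [measurable]: "X \<in> borel_measurable M" "Y \<in> borel_measurable M"
    and pos: "\<P>(\<omega> in M. X \<omega> < a \<and> Y \<omega> = b) > 0"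
  obtains K e :: real where "e > 0"
    and "\<P>(\<omega> in M. Y \<omega> < b) <
      \<P>(\<omega> in M. X \<omega> \<le> a - e \<and> Y \<omega> \<le> b \<or> X \<omega> \<le> K \<and> Y \<omega> \<le> b - e)"
proof -
  define e where "e n = inverse (real (Suc n))" for n
  define A where
    "A n = {\<omega> \<in> space M. X \<omega> \<le> a - e n \<and> Y \<omega> \<le> b \<or> X \<omega> \<le> real n \<and> Y \<omega> \<le> b - e n}" for n
  have e_anti: "e n \<le> e m" if "m \<le> n" for m n
    using that by (simp add: e_def field_simps)
  have e_small: "\<exists>n. e n < d" if "d > 0" for d
    using reals_Archimedean[OF that] by (simp add: e_def)
  have meas: "range A \<subseteq> sets M"
    by (auto simp: A_def)
  have "incseq A"
  proof (rule incseq_SucI, rule subsetI)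
    fix n \<omega> assume "\<omega> \<in> A n"
    then show "\<omega> \<in> A (Suc n)"
      using e_anti[of n "Suc n"] by (auto simp: A_def)
  qed
  with meas have lim: "(\<lambda>n. prob (A n)) \<longlonglongrightarrow> prob (\<Union>n. A n)"
    by (rule finite_Lim_measure_incseq)
  have "{\<omega> \<in> space M. Y \<omega> < b} \<union> {\<omega> \<in> space M. X \<omega> < a \<and> Y \<omega> = b} \<subseteq> (\<Union>n. A n)"
  proof (intro Un_least subsetI)
    fix \<omega> assume w: "\<omega> \<in> {\<omega> \<in> space M. Y \<omega> < b}"
    obtain m where m: "e m < b - Y \<omega>" using e_small[of "b - Y \<omega>"] w by auto
    obtain k :: nat where k: "X \<omega> \<le> real k" using real_arch_simple by blast
    have "\<omega> \<in> A (max m k)"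
      using w m k e_anti[of m "max m k"] by (auto simp: A_def)
    then show "\<omega> \<in> (\<Union>n. A n)" by blast
  next
    fix \<omega> assume w: "\<omega> \<in> {\<omega> \<in> space M. X \<omega> < a \<and> Y \<omega> = b}"
    obtain m where "e m < a - X \<omega>" using e_small[of "a - X \<omega>"] w by auto
    then have "\<omega> \<in> A m" using w by (auto simp: A_def)
    then show "\<omega> \<in> (\<Union>n. A n)" by blast
  qed
  then have "prob ({\<omega> \<in> space M. Y \<omega> < b} \<union> {\<omega> \<in> space M. X \<omega> < a \<and> Y \<omega> = b})
      \<le> prob (\<Union>n. A n)"
    using meas by (intro finite_measure_mono) auto
  moreover have "prob ({\<omega> \<in> space M. Y \<omega> < b} \<union> {\<omega> \<in> space M. X \<omega> < a \<and> Y \<omega> = b})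
      = \<P>(\<omega> in M. Y \<omega> < b) + \<P>(\<omega> in M. X \<omega> < a \<and> Y \<omega> = b)"
    by (intro finite_measure_Union) auto
  ultimately have "\<P>(\<omega> in M. Y \<omega> < b) < prob (\<Union>n. A n)"
    using pos by linarith
  then have "eventually (\<lambda>n. \<P>(\<omega> in M. Y \<omega> < b) < prob (A n)) sequentially"
    using lim by (intro order_tendstoD)
  then obtain n where "\<P>(\<omega> in M. Y \<omega> < b) < prob (A n)"
    by (auto simp: eventually_sequentially)
  then show thesis
    by (intro that[of "e n" "real n"]) (auto simp: A_def e_def)
qed

end

text \<open>If \<open>\<theta>\<close> is small, then a margin \<open>e\<close> in the second coordinate outweighs any excess of the
  first one over \<open>a\<close>, up to the bound \<open>K\<close>.\<close>

lemma small_weight_strictly_below: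
  fixes a b e K :: real
  assumes "e > 0"
  obtains \<theta> t where "0 < \<theta>" "\<theta> < 1" "t < \<theta> * a + (1 - \<theta>) * b"
    and "\<And>u v. u \<le> a - e \<and> v \<le> b \<or> u \<le> K \<and> v \<le> b - e \<Longrightarrow> \<theta> * u + (1 - \<theta>) * v \<le> t"
proof -
  \<comment> \<open>The inequality \<open>\<theta> * (K - a) < (1 - \<theta>) * e\<close> is what the second alternative requires;
    this \<open>\<theta>\<close> solves \<open>\<theta> * (\<bar>K - a\<bar> + 2 * e) = e\<close>.\<close>
  define \<theta> where "\<theta> = e / (\<bar>K - a\<bar> + 2 * e)"
  have \<theta>: "0 < \<theta>" "\<theta> < 1"
    using assms by (auto simp: \<theta>_def field_simps)
  have "\<theta> * (\<bar>K - a\<bar> + 2 * e) = e"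
    using assms by (simp add: \<theta>_def)
  moreover have "\<theta> * (K - a) \<le> \<theta> * \<bar>K - a\<bar>"
    using \<theta> by (intro mult_left_mono) auto
  moreover have "\<theta> * e > 0"
    using \<theta> assms by simp
  ultimately have small: "\<theta> * (K - a) < (1 - \<theta>) * e"
    by (simp add: algebra_simps)
  define t where
    "t = max (\<theta> * (a - e) + (1 - \<theta>) * b) (\<theta> * K + (1 - \<theta>) * (b - e))"
  show thesis
  proof (rule that[OF \<theta>])
    show "t < \<theta> * a + (1 - \<theta>) * b"
      using small \<open>\<theta> * e > 0\<close> by (simp add: t_def algebra_simps)
  next
    fix u v assume "u \<le> a - e \<and> v \<le> b \<or> u \<le> K \<and> v \<le> b - e"
    then have "\<theta> * u + (1 - \<theta>) * v \<le> \<theta> * (a - e) + (1 - \<theta>) * b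
        \<or> \<theta> * u + (1 - \<theta>) * v \<le> \<theta> * K + (1 - \<theta>) * (b - e)"
      using \<theta> by (auto intro!: add_mono mult_left_mono)
    then show "\<theta> * u + (1 - \<theta>) * v \<le> t"
      by (auto simp: t_def)
  qed
qed

text \<open>The level \<open>p\<close> can be taken between \<open>P (Y < b)\<close> and the probability of the approximating
  event: the first keeps both individual Values-at-Risk up at \<open>a\<close> and \<open>b\<close>, the second pulls that
  of the combination strictly below \<open>\<theta> a + (1 - \<theta>) b\<close>.\<close>

lemma (in prob_space) weighted_VaR_superadditivity_fails:
  assumes [measurable]: "X \<in> borel_measurable M" "Y \<in> borel_measurable M"
    and le: "\<P>(\<omega> in M. X \<omega> < a) \<le> \<P>(\<omega> in M. Y \<omega> < b)"
    and pos: "\<P>(\<omega> in M. X \<omega> < a \<and> Y \<omega> = b) > 0"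
  obtains p \<theta> where "0 < p" "p < 1" "0 < \<theta>" "\<theta> < 1"
    and "VaR M p (\<lambda>\<omega>. \<theta> * X \<omega> + (1 - \<theta>) * Y \<omega>)
      < VaR M p (\<lambda>\<omega>. \<theta> * X \<omega>) + VaR M p (\<lambda>\<omega>. (1 - \<theta>) * Y \<omega>)"
proof -
  obtain K e :: real where e: "e > 0"
    and gain: "\<P>(\<omega> in M. Y \<omega> < b) <
      \<P>(\<omega> in M. X \<omega> \<le> a - e \<and> Y \<omega> \<le> b \<or> X \<omega> \<le> K \<and> Y \<omega> \<le> b - e)" (is "?v < ?q")
    using lexicographic_event_inner_approximation[OF assms(1,2) pos] .
  obtain \<theta> t where \<theta>: "0 < \<theta>" "\<theta> < 1" and t: "t < \<theta> * a + (1 - \<theta>) * b"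
    and below: "\<And>u v. u \<le> a - e \<and> v \<le> b \<or> u \<le> K \<and> v \<le> b - e
      \<Longrightarrow> \<theta> * u + (1 - \<theta>) * v \<le> t"
    using small_weight_strictly_below[OF e, where a = a and b = b and K = K] by blast
  obtain p where p: "?v < p" "p < ?q"
    using dense[OF gain] by blast
  have "0 \<le> ?v" "?q \<le> 1" by auto
  with p have p01: "0 < p" "p < 1" by linarith+
  have "?q \<le> \<P>(\<omega> in M. \<theta> * X \<omega> + (1 - \<theta>) * Y \<omega> \<le> t)"
    using below by (intro finite_measure_mono) auto
  then have "VaR M p (\<lambda>\<omega>. \<theta> * X \<omega> + (1 - \<theta>) * Y \<omega>) \<le> t"
    using p p01 by (intro VaR_le) auto
  moreover have "\<theta> * a \<le> VaR M p (\<lambda>\<omega>. \<theta> * X \<omega>)"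
    using p p01 le \<theta> by (intro VaR_ge) auto
  moreover have "(1 - \<theta>) * b \<le> VaR M p (\<lambda>\<omega>. (1 - \<theta>) * Y \<omega>)"
    using p p01 \<theta> by (intro VaR_ge) auto
  ultimately show thesis
    using t by (intro that[OF p01 \<theta>]) linarith
qed

lemma WUVS_pairD:
  assumes "WUVS M [X, Y]" and "0 < p" "p < 1" "0 \<le> \<theta>" "\<theta> \<le> 1"
  shows "VaR M p (\<lambda>\<omega>. \<theta> * X \<omega>) + VaR M p (\<lambda>\<omega>. (1 - \<theta>) * Y \<omega>)
    \<le> VaR M p (\<lambda>\<omega>. \<theta> * X \<omega> + (1 - \<theta>) * Y \<omega>)"
proof -
  have "[\<theta>, 1 - \<theta>] \<in> weight_simplex (length [X, Y])"
    using assms by (auto simp: weight_simplex_def numeral_2_eq_2)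
  moreover have "p \<in> {0<..<1}"
    using assms by simp
  ultimately show ?thesis
    using assms(1) unfolding WUVS_def by (fastforce simp: numeral_2_eq_2)
qed

text \<open>Whichever of \<open>P (X < a)\<close> and \<open>P (Y < b)\<close> is larger, one of the two discordant events
  breaks superadditivity: the one in which the variable with the larger of these probabilities sits
  at its level.\<close>

lemma (in prob_space) discordant_atoms_not_WUVS:
  assumes meas: "X \<in> borel_measurable M" "Y \<in> borel_measurable M"
    and "\<P>(\<omega> in M. X \<omega> < a \<and> Y \<omega> = b) > 0"
    and "\<P>(\<omega> in M. X \<omega> = a \<and> Y \<omega> < b) > 0"
  shows "\<not> WUVS M [X, Y]"
proof
  assume W: "WUVS M [X, Y]"
  show False
  proof (cases "\<P>(\<omega> in M. X \<omega> < a) \<le> \<P>(\<omega> in M. Y \<omega> < b)")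
    case True
    obtain p \<theta> where "0 < p" "p < 1" "0 < \<theta>" "\<theta> < 1"
      and "VaR M p (\<lambda>\<omega>. \<theta> * X \<omega> + (1 - \<theta>) * Y \<omega>)
        < VaR M p (\<lambda>\<omega>. \<theta> * X \<omega>) + VaR M p (\<lambda>\<omega>. (1 - \<theta>) * Y \<omega>)"
      using weighted_VaR_superadditivity_fails[OF meas True assms(3)] .
    then show False
      using WUVS_pairD[OF W, of p \<theta>] by simp
  next
    case False
    then have le: "\<P>(\<omega> in M. Y \<omega> < b) \<le> \<P>(\<omega> in M. X \<omega> < a)"
      by simp
    have pos: "\<P>(\<omega> in M. Y \<omega> < b \<and> X \<omega> = a) > 0"
      using assms(4) by (simp add: conj_commute)
    obtain p \<theta> where "0 < p" "p < 1" "0 < \<theta>" "\<theta> < 1"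
      and "VaR M p (\<lambda>\<omega>. \<theta> * Y \<omega> + (1 - \<theta>) * X \<omega>)
        < VaR M p (\<lambda>\<omega>. \<theta> * Y \<omega>) + VaR M p (\<lambda>\<omega>. (1 - \<theta>) * X \<omega>)"
      using weighted_VaR_superadditivity_fails[OF meas(2,1) le pos] .
    then show False
      using WUVS_pairD[OF W, of p "1 - \<theta>"] by (simp add: add.commute)
  qed
qed

theorem theorem2p1:
  fixes M :: "'a measure" and X Y :: "'a \<Rightarrow> real"
    and I J :: "int set" and x y :: "int \<Rightarrow> real" and i j :: int
  assumes "prob_space M"
    and "discrete_rv M X I x"
    and "discrete_rv M Y J y"
    and "i \<in> I" and "i + 1 \<in> I"
    and "j \<in> J" and "j + 1 \<in> J"
    and "\<P>(\<omega> in M. X \<omega> = x (i + 1) \<and> Y \<omega> = y j) > 0"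
    and "\<P>(\<omega> in M. X \<omega> = x i \<and> Y \<omega> = y (j + 1)) > 0"
  shows "\<not> WUVS M [X, Y]"
proof -
  interpret prob_space M by fact
  have meas[measurable]: "X \<in> borel_measurable M" "Y \<in> borel_measurable M"
    using assms(2,3) by (auto simp: discrete_rv_def)
  have lt: "x i < x (i + 1)" "y j < y (j + 1)"
    using assms(2-7) by (auto simp: discrete_rv_def strict_mono_on_def)
  have "\<P>(\<omega> in M. X \<omega> = x i \<and> Y \<omega> = y (j + 1))
      \<le> \<P>(\<omega> in M. X \<omega> < x (i + 1) \<and> Y \<omega> = y (j + 1))"
    using lt by (intro finite_measure_mono) auto
  moreover have "\<P>(\<omega> in M. X \<omega> = x (i + 1) \<and> Y \<omega> = y j)
      \<le> \<P>(\<omega> in M. X \<omega> = x (i + 1) \<and> Y \<omega> < y (j + 1))"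
    using lt by (intro finite_measure_mono) auto
  ultimately show ?thesis
    using assms(8,9)
    by (intro discordant_atoms_not_WUVS[OF meas, of "x (i + 1)" "y (j + 1)"]) linarith+
qed

end
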